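(* Let $\mathcal{I}$ be an ideal on $\omega$, let $X$ be a metric space with metric $d$ having the UC-property, and fix a point $\eta\in X$. Let also $\mathscr{F}=\{F_\lambda:\lambda\in X\}$ be a rough family on $X$ such that $F_\eta$ is closed. Then, for every sequence $\bm{x}\in X^\omega$, one has $\eta\in\Lambda_{\bm{x}}(\mathcal{I},\mathscr{F})$ if and only if $0\in\Lambda_{d(\bm{x},F_\eta)}(\mathcal{I})$.
   Context: $\omega$ is the set of nonnegative integers. An ideal $\mathcal{I}$ on $\omega$ is a family $\mathcal{I}\subseteq\mathcal{P}(\omega)$ closed under subsets and finite unions, containing all finite subsets of $\omega$, and with $\omega\notin\mathcal{I}$. Write $\mathcal{I}^+:=\mathcal{P}(\omega)\setminus\mathcal{I}$. A rough family on a topological space $X$ is a collection $\mathscr{F}=\{F_\eta:\eta\in X\}$ of subsets of $X$ such that $\eta\in F_\eta$ for all $\eta\in X$. For a sequence $\bm{x}=(x_n:n\in\omega)$ in $X$ and an infinite $S\subseteq\omega$, the subsequence $(x_n:n\in S)$ is $\mathscr{F}$-convergent to $\eta$ if $\{n\in S:x_n\notin U\}$ is finite for all open $U\subseteq X$ with $F_\eta\subseteq U$. $\Lambda_{\bm{x}}(\mathcal{I},\mathscr{F})$ is the set of all $\eta\in X$ for which there exists $S\in\mathcal{I}^+$ such that $(x_n:n\in S)$ is $\mathscr{F}$-convergent to $\eta$. $\Lambda_{\bm{x}}(\mathcal{I})$ is this set for the rough family of singletons, i.e. the set of all $\eta$ for which there exists $S\in\mathcal{I}^+$ such that $(x_n:n\in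 S)$ converges to $\eta$ in the usual sense. For nonempty $Y\subseteq X$, $d(\bm{x},Y)$ is the real sequence $(d(x_n,Y):n\in\omega)$, where $d(x_n,Y):=\inf\{d(x_n,y):y\in Y\}$; its $\mathcal{I}$-limit points are taken in $\mathbb{R}$ with the standard topology. A metric space $(X,d)$ has the UC-property if for all nonempty disjoint closed sets $F,F'\subseteq X$ there exists $\varepsilon>0$ such that $d(x,x')>\varepsilon$ for all $x\in F$ and $x'\in F'$. *)

theory Defs
  imports "HOL-Analysis.Analysis"
begin

definition ideal_on_omega :: "nat set set \<Rightarrow> bool" where
  "ideal_on_omega I \<longleftrightarrow>
     (\<forall>A\<in>I. \<forall>B. B \<subseteq> A \<longrightarrow> B \<in> I) \<and>
     (\<forall>A\<in>I. \<forall>B\<in>I. A \<union> B \<in> I) \<and>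
     (\<forall>A. finite A \<longrightarrow> A \<in> I) \<and>
     UNIV \<notin> I"

definition positive_sets :: "nat set set \<Rightarrow> nat set set" where
  "positive_sets I = UNIV - I"

definition rough_family :: "('a \<Rightarrow> 'a set) \<Rightarrow> bool" where
  "rough_family F \<longleftrightarrow> (\<forall>\<eta>. \<eta> \<in> F \<eta>)"

text \<open>The subsequence of \<open>x\<close> along \<open>S\<close> converges roughly to \<open>\<eta>\<close>. The notion is only meaningful for
  infinite \<open>S\<close>; sets outside an ideal are infinite, as ideals contain all finite sets.\<close>

definition rough_convergent ::
    "('a::topological_space \<Rightarrow> 'a set) \<Rightarrow> (nat \<Rightarrow> 'a) \<Rightarrow> nat set \<Rightarrow> 'a \<Rightarrow> bool" where
  "rough_convergent F x S \<eta> \<longleftrightarrow>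
     (\<forall>U. open U \<longrightarrow> F \<eta> \<subseteq> U \<longrightarrow> finite {n\<in>S. x n \<notin> U})"

definition rough_limit_points ::
    "(nat \<Rightarrow> 'a::topological_space) \<Rightarrow> nat set set \<Rightarrow> ('a \<Rightarrow> 'a set) \<Rightarrow> 'a set" where
  "rough_limit_points x I F = {\<eta>. \<exists>S\<in>positive_sets I. rough_convergent F x S \<eta>}"

definition ideal_limit_points ::
    "(nat \<Rightarrow> 'a::topological_space) \<Rightarrow> nat set set \<Rightarrow> 'a set" where
  "ideal_limit_points x I = rough_limit_points x I (\<lambda>\<eta>. {\<eta>})"

definition UC_property :: "'a::metric_space itself \<Rightarrow> bool" where
  "UC_property _ \<longleftrightarrow>
     (\<forall>F F' :: 'a set. closed F \<longrightarrow> closed F' \<longrightarrow> F \<noteq> {} \<longrightarrow> F' \<noteq> {} \<longrightarrow> F \<inter> F' = {} \<longrightarrow>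
        (\<exists>\<epsilon>>0. \<forall>x\<in>F. \<forall>x'\<in>F'. dist x x' > \<epsilon>))"

end

theory Submission
  imports Defs
begin

text \<open>Both conditions are witnessed by the same set of indices: by the UC-property, the open sets
  containing a nonempty closed set \<open>A\<close> are exactly the open sets containing a uniform
  neighbourhood \<open>{y. infdist y A < \<epsilon>}\<close> of \<open>A\<close>.\<close>

lemma UC_property_uniform_neighbourhood:
  fixes A U :: "'a::metric_space set"
  assumes UC: "UC_property TYPE('a)"
    and A: "closed A" "A \<noteq> {}"
    and U: "open U" "A \<subseteq> U"
  obtains \<epsilon> where "\<epsilon> > 0" "{y. infdist y A < \<epsilon>} \<subseteq> U"
proof (cases "U = UNIV")
  case True
  \<comment> \<open>The UC-property speaks of nonempty sets only, so an empty complement is treated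
    apart; any positive radius works.\<close>
  then show ?thesis using that[of 1] by simp
next
  case False
  then have "closed (- U)" "- U \<noteq> {}" "A \<inter> - U = {}"
    using U by auto
  with UC A obtain \<epsilon> where \<epsilon>: "\<epsilon> > 0" "\<And>a y. a \<in> A \<Longrightarrow> y \<in> - U \<Longrightarrow> dist a y > \<epsilon>"
    unfolding UC_property_def by meson
  \<comment> \<open>The strict gap between \<open>A\<close> and \<open>- U\<close> survives the
    infimum only as a weak bound, which still excludes points with
    \<open>infdist y A < \<epsilon>\<close>.\<close>
  have "\<epsilon> \<le> infdist y A" if "y \<notin> U" for y
    unfolding infdist_notempty[OF A(2)]
    using A(2) \<epsilon>(2) that by (intro cINF_greatest) (auto simp: dist_commute less_imp_le)
  then have "{y. infdist y A < \<epsilon>} \<subseteq> U"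
    by (auto simp: not_le[symmetric])
  with \<epsilon>(1) show ?thesis by (rule that)
qed

text \<open>Neighbourhoods of 0 pull back along the continuous distance function to open sets
  containing \<open>F \<eta>\<close>; conversely, each open set containing \<open>F \<eta>\<close>
  contains such a pullback by the UC-property.\<close>

lemma rough_convergent_iff_infdist:
  fixes x :: "nat \<Rightarrow> 'a::metric_space"
  assumes UC: "UC_property TYPE('a)"
    and A: "closed (F \<eta>)" "F \<eta> \<noteq> {}"
  shows "rough_convergent F x S \<eta> \<longleftrightarrow>
         rough_convergent (\<lambda>r::real. {r}) (\<lambda>n. infdist (x n) (F \<eta>)) S 0"
    (is "?L \<longleftrightarrow> ?R")
proof
  assume L: ?L
  show ?R
    unfolding rough_convergent_def
  proof (intro allI impI)
    fix V :: "real set"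
    assume V: "open V" "{0} \<subseteq> V"
    let ?U = "(\<lambda>y. infdist y (F \<eta>)) -` V"
    have "open ?U"
      using V(1) by (intro open_vimage continuous_intros)
    moreover have "F \<eta> \<subseteq> ?U"
      using V(2) by auto
    ultimately have "finite {n\<in>S. x n \<notin> ?U}"
      using L unfolding rough_convergent_def by blast
    then show "finite {n\<in>S. infdist (x n) (F \<eta>) \<notin> V}"
      by simp
  qed
next
  assume R: ?R
  show ?L
    unfolding rough_convergent_def
  proof (intro allI impI)
    fix U
    assume U: "open U" "F \<eta> \<subseteq> U"
    from UC_property_uniform_neighbourhood[OF UC A U]
    obtain \<epsilon> where \<epsilon>: "\<epsilon> > 0" "{y. infdist y (F \<eta>) < \<epsilon>} \<subseteq> U" .
    \<comment> \<open>The open ray \<open>{..<\<epsilon>}\<close> serves as the neighbourhood of 0: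
      its preimage under the distance is the uniform neighbourhood inside \<open>U\<close>.\<close>
    have "finite {n\<in>S. infdist (x n) (F \<eta>) \<notin> {..<\<epsilon>}}"
      using R \<epsilon>(1) unfolding rough_convergent_def
      by (elim allE[of _ "{..<\<epsilon>}"]) simp
    then show "finite {n\<in>S. x n \<notin> U}"
      by (rule finite_subset[rotated]) (use \<epsilon>(2) in auto)
  qed
qed

theorem theorem2p14:
  fixes I :: "nat set set"
    and \<eta> :: "'a::metric_space"
    and F :: "'a \<Rightarrow> 'a set"
    and x :: "nat \<Rightarrow> 'a"
  assumes "ideal_on_omega I"
    and "UC_property TYPE('a)"
    and "rough_family F"
    and "closed (F \<eta>)"
  shows "\<eta> \<in> rough_limit_points x I F \<longleftrightarrow>
         (0::real) \<in> ideal_limit_points (\<lambda>n. infdist (x n) (F \<eta>)) I"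
proof -
  \<comment> \<open>Roughness puts \<open>\<eta>\<close> itself in \<open>F \<eta>\<close>, so
    \<open>infdist\<close> is a genuine infimum here and not its default value 0 for the empty
    set.\<close>
  have "F \<eta> \<noteq> {}"
    using assms(3) by (auto simp: rough_family_def)
  from rough_convergent_iff_infdist[of F \<eta>, OF assms(2,4) this] show ?thesis
    by (simp add: ideal_limit_points_def rough_limit_points_def)
qed

end
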